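(* Let $G$ be a finite simple triangle-free graph and let $H$ be a graph with vertex set $E(G)$. Then $H=L_G$ if and only if there exists a set $F\subseteq E(H)$ such that $H-F=L(G)$ and (i) whenever $H-F$ contains an induced four-cycle with vertices $a,b,c,d$ and edges $ab,bc,cd,ad$, we have $ac,bd\in F$; and (ii) whenever $ac\in F$, there exist vertices $b,d$ with $bd\in F$ such that $a,b,c,d$ induce a four-cycle in $H-F$.
   Context: A biclique of $G$ is a vertex set $B\subseteq V(G)$ such that $G[B]$ is a complete bipartite graph and $B$ is inclusion-wise maximal with this property. The biclique line graph $L_G$ has vertex set $E(G)$, two edges of $G$ being adjacent iff they are both edges of $G[B]$ for some biclique $B$ of $G$. $L(G)$ is the ordinary line graph of $G$ (vertex set $E(G)$, two edges adjacent iff they share an endpoint). $H-F$ denotes the graph obtained from $H$ by deleting the edges in $F$. *)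

theory Defs
  imports Main "HOL-Library.Ramsey"
begin

datatype 'a ugraph = Graph (verts: "'a set") (edges: "'a set set")

definition simple_graph :: "'a ugraph \<Rightarrow> bool" where
  "simple_graph G \<longleftrightarrow> edges G \<subseteq> nsets (verts G) 2"

definition triangle_free :: "'a ugraph \<Rightarrow> bool" where
  "triangle_free G \<longleftrightarrow>
     \<not> (\<exists>x y z. {x, y} \<in> edges G \<and> {y, z} \<in> edges G \<and> {x, z} \<in> edges G)"

definition induced_subgraph :: "'a ugraph \<Rightarrow> 'a set \<Rightarrow> 'a ugraph" where
  "induced_subgraph G B = Graph (verts G \<inter> B) {e \<in> edges G. e \<subseteq> B}"

text \<open>Both parts are required to be nonempty. Admitting empty parts would only add edgeless
  bicliques, which contribute nothing to the biclique line graph.\<close>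

definition complete_bipartite :: "'a ugraph \<Rightarrow> bool" where
  "complete_bipartite G \<longleftrightarrow>
     (\<exists>X Y. X \<noteq> {} \<and> Y \<noteq> {} \<and> X \<inter> Y = {} \<and> verts G = X \<union> Y \<and>
            edges G = {{x, y} | x y. x \<in> X \<and> y \<in> Y})"

definition biclique :: "'a ugraph \<Rightarrow> 'a set \<Rightarrow> bool" where
  "biclique G B \<longleftrightarrow>
     B \<subseteq> verts G \<and> complete_bipartite (induced_subgraph G B) \<and>
     (\<forall>B'. B \<subseteq> B' \<and> B' \<subseteq> verts G \<and> complete_bipartite (induced_subgraph G B') \<longrightarrow> B' = B)"

definition biclique_line_graph :: "'a ugraph \<Rightarrow> 'a set ugraph" where
  "biclique_line_graph G = Graph (edges G)
     {{e, f} | e f. e \<noteq> f \<and>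
        (\<exists>B. biclique G B \<and> e \<in> edges (induced_subgraph G B) \<and> f \<in> edges (induced_subgraph G B))}"

definition line_graph :: "'a ugraph \<Rightarrow> 'a set ugraph" where
  "line_graph G = Graph (edges G)
     {{e, f} | e f. e \<in> edges G \<and> f \<in> edges G \<and> e \<noteq> f \<and> e \<inter> f \<noteq> {}}"

definition delete_edges :: "'a ugraph \<Rightarrow> 'a set set \<Rightarrow> 'a ugraph" where
  "delete_edges H F = Graph (verts H) (edges H - F)"

definition induced_four_cycle :: "'a ugraph \<Rightarrow> 'a \<Rightarrow> 'a \<Rightarrow> 'a \<Rightarrow> 'a \<Rightarrow> bool" where
  "induced_four_cycle H a b c d \<longleftrightarrow>
     distinct [a, b, c, d] \<and>
     induced_subgraph H {a, b, c, d} = Graph {a, b, c, d} {{a, b}, {b, c}, {c, d}, {a, d}}"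

text \<open>The set \<open>S\<close> induces a four-cycle, in some cyclic order of its elements.\<close>

definition induces_four_cycle :: "'a ugraph \<Rightarrow> 'a set \<Rightarrow> bool" where
  "induces_four_cycle H S \<longleftrightarrow> (\<exists>a b c d. S = {a, b, c, d} \<and> induced_four_cycle H a b c d)"

end

theory Submission
  imports Defs
begin

text \<open>In a triangle-free graph, two distinct edges lie in a common biclique iff they share an
  endpoint or are opposite edges of a four-cycle: two edges of a complete bipartite graph are of
  one of these kinds, and conversely the star or four-cycle they span is an induced complete
  bipartite graph, which extends to a biclique. On the other hand, the induced four-cycles of the
  line graph are exactly the edge sets of the four-cycles of the graph. So both sides of the
  equivalence say that the edges of \<open>H\<close> are those of the line graph together with the pairs of
  opposite edges of four-cycles.\<close>

definition opposite_in_four_cycle :: "'a ugraph \<Rightarrow> 'a set \<Rightarrow> 'a set \<Rightarrow> bool" where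
  "opposite_in_four_cycle G e f \<longleftrightarrow>
     (\<exists>p q r s. distinct [p, q, r, s] \<and> e = {p, q} \<and> f = {r, s} \<and>
        {p, q} \<in> edges G \<and> {q, r} \<in> edges G \<and> {r, s} \<in> edges G \<and> {p, s} \<in> edges G)"

section \<open>Edges of simple graphs as pairs of vertices\<close>

lemma simple_graph_edgeE:
  assumes "simple_graph G" and "e \<in> edges G"
  obtains x y where "x \<noteq> y" and "e = {x, y}" and "x \<in> verts G" and "y \<in> verts G"
proof -
  have "card e = 2" "e \<subseteq> verts G"
    using assms by (auto simp: simple_graph_def nsets_def)
  then show thesis
    using that by (auto simp: card_2_iff)
qed

lemma simple_graph_edge_eq:
  assumes "simple_graph G" and "e \<in> edges G" and "x \<in> e" and "y \<in> e" and "x \<noteq> y"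
  shows "e = {x, y}"
proof -
  obtain u v where "e = {u, v}"
    using simple_graph_edgeE[OF assms(1,2)] by blast
  then show ?thesis
    using assms(3-5) by auto
qed

lemma simple_graph_no_loop:
  assumes "simple_graph G"
  shows "{x} \<notin> edges G"
  using assms by (auto simp: simple_graph_def nsets_def)

section \<open>Pairs of edges in a common biclique\<close>

text \<open>Two vertices on the same side have a common neighbour on the other side, so an edge
  between them would close a triangle. The sides are disjoint because a common vertex would carry a
  loop.\<close>

lemma complete_bipartite_induced_if_triangle_free:
  assumes G: "simple_graph G" "triangle_free G"
    and "X \<noteq> {}" "Y \<noteq> {}"
    and XY: "\<And>x y. x \<in> X \<Longrightarrow> y \<in> Y \<Longrightarrow> {x, y} \<in> edges G"
  shows "complete_bipartite (induced_subgraph G (X \<union> Y))"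
proof -
  obtain x0 y0 where x0: "x0 \<in> X" and y0: "y0 \<in> Y"
    using assms by blast
  have indepX: "{u, v} \<notin> edges G" if "u \<in> X" "v \<in> X" for u v
    using G(2) XY[OF that(1) y0] XY[OF that(2) y0]
    unfolding triangle_free_def by blast
  have indepY: "{u, v} \<notin> edges G" if "u \<in> Y" "v \<in> Y" for u v
    using G(2) XY[OF x0 that(1)] XY[OF x0 that(2)]
    unfolding triangle_free_def by blast
  have "X \<inter> Y = {}"
    using XY simple_graph_no_loop[OF G(1)] by fastforce
  moreover have "X \<union> Y \<subseteq> verts G"
  proof -
    have "{x, y} \<subseteq> verts G" if "x \<in> X" "y \<in> Y" for x y
      using XY[OF that] G(1) by (auto simp: simple_graph_def nsets_def)
    then show ?thesis
      using x0 y0 by blast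
  qed
  moreover have "{e \<in> edges G. e \<subseteq> X \<union> Y} = {{x, y} | x y. x \<in> X \<and> y \<in> Y}" (is "?L = ?R")
  proof
    show "?L \<subseteq> ?R"
    proof
      fix e assume e: "e \<in> ?L"
      then obtain u v where uv: "e = {u, v}"
        using G(1) by (blast elim: simple_graph_edgeE)
      have "u \<in> X \<and> v \<in> Y \<or> v \<in> X \<and> u \<in> Y"
        using e indepX indepY unfolding uv by blast
      then show "e \<in> ?R"
        unfolding uv by (auto simp: insert_commute)
    qed
    show "?R \<subseteq> ?L"
      using XY by blast
  qed
  ultimately show ?thesis
    unfolding complete_bipartite_def induced_subgraph_def
    using assms(3,4) by - (rule exI[of _ X], rule exI[of _ Y], auto)
qed

text \<open>A finite vertex set has only finitely many subsets, so among those inducing a complete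
  bipartite graph and containing \<open>B\<close> there is a maximal one.\<close>

lemma biclique_extension:
  assumes "finite (verts G)" and "B \<subseteq> verts G" and "complete_bipartite (induced_subgraph G B)"
  obtains B' where "B \<subseteq> B'" and "biclique G B'"
proof -
  let ?S = "{B'. B' \<subseteq> verts G \<and> complete_bipartite (induced_subgraph G B')}"
  have "finite ?S"
    using assms(1) by simp
  moreover have "B \<in> ?S"
    using assms by simp
  ultimately obtain B' where B': "B' \<in> ?S" "B \<subseteq> B'" "\<forall>C\<in>?S. B' \<subseteq> C \<longrightarrow> B' = C"
    using finite_has_maximal2[of ?S B] by blast
  have "biclique G B'"
    unfolding biclique_def using B'(1,3) by auto
  with B'(2) show thesis
    by (rule that)
qed

text \<open>The case \<open>e = f\<close> is included: an edge meets itself and lies in a biclique.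
  Distinctness enters only when adjacency is formed. A chord of the four-cycle would close a
  triangle, so the cycle is automatically induced.\<close>

lemma common_biclique_iff:
  assumes G: "simple_graph G" "finite (verts G)" "triangle_free G"
  shows "(\<exists>B. biclique G B \<and> e \<in> edges (induced_subgraph G B) \<and> f \<in> edges (induced_subgraph G B))
    \<longleftrightarrow> e \<in> edges G \<and> f \<in> edges G \<and> (e \<inter> f \<noteq> {} \<or> opposite_in_four_cycle G e f)"
    (is "?L \<longleftrightarrow> ?R")
proof
  assume ?L
  then obtain B where B: "complete_bipartite (induced_subgraph G B)"
    and ef: "e \<in> edges (induced_subgraph G B)" "f \<in> edges (induced_subgraph G B)"
    unfolding biclique_def by blast
  obtain X Y where disj: "X \<inter> Y = {}"
    and edges: "edges (induced_subgraph G B) = {{x, y} | x y. x \<in> X \<and> y \<in> Y}"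
    using B unfolding complete_bipartite_def by (elim exE conjE)
  have XY: "{x, y} \<in> edges G" if "x \<in> X" "y \<in> Y" for x y
    using edges that by (auto simp: induced_subgraph_def)
  obtain p q where pq: "e = {p, q}" "p \<in> X" "q \<in> Y"
    using ef(1) edges by auto
  obtain r s where rs: "f = {r, s}" "r \<in> X" "s \<in> Y"
    using ef(2) edges by auto
  \<comment> \<open>Disjointness of the edges and of the sides makes the four ends distinct; the
    complete join supplies the connecting edges \<open>{q, r}\<close> and
    \<open>{p, s}\<close>.\<close>
  have "opposite_in_four_cycle G e f" if "e \<inter> f = {}"
    unfolding opposite_in_four_cycle_def
  proof (intro exI conjI)
    show "distinct [p, q, r, s]"
      using that disj pq rs by auto
    show "{q, r} \<in> edges G"
      using XY[OF rs(2) pq(3)] by (simp add: insert_commute)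
  qed (use pq rs XY in auto)
  then show ?R
    using ef by (auto simp: induced_subgraph_def)
next
  assume R: ?R
  \<comment> \<open>Only the edges between the two sides are asked for here; triangle-freeness then
    excludes edges within a side.\<close>
  have "\<exists>X Y. X \<noteq> {} \<and> Y \<noteq> {} \<and> e \<subseteq> X \<union> Y \<and> f \<subseteq> X \<union> Y \<and>
          (\<forall>x\<in>X. \<forall>y\<in>Y. {x, y} \<in> edges G)"
  proof (cases "e \<inter> f = {}")
    case True
    then obtain p q r s where
      "e = {p, q}" "f = {r, s}" "{p, q} \<in> edges G" "{q, r} \<in> edges G"
      "{r, s} \<in> edges G" "{p, s} \<in> edges G"
      using R unfolding opposite_in_four_cycle_def by blast
    \<comment> \<open>The sides are the two colour classes of the four-cycle.\<close>
    then show ?thesis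
      by - (rule exI[of _ "{p, r}"], rule exI[of _ "{q, s}"], auto simp: insert_commute)
  next
    case False
    then obtain u where "u \<in> e" "u \<in> f"
      by blast
    have other_end: "\<exists>v. g = {u, v}" if g: "g \<in> edges G" "u \<in> g" for g
    proof -
      obtain x y where "g = {x, y}"
        using simple_graph_edgeE[OF G(1) g(1)] by blast
      then show ?thesis
        using g(2) by (auto simp: insert_commute)
    qed
    obtain v w where "e = {u, v}" "f = {u, w}"
      using R other_end[of e] other_end[of f] \<open>u \<in> e\<close> \<open>u \<in> f\<close> by blast
    \<comment> \<open>The star with centre \<open>u\<close>; it is a single edge when
      \<open>v = w\<close>.\<close>
    then show ?thesis
      using R by - (rule exI[of _ "{u}"], rule exI[of _ "{v, w}"], auto)
  qed
  then obtain X Y where XY: "X \<noteq> {}" "Y \<noteq> {}" "e \<subseteq> X \<union> Y" "f \<subseteq> X \<union> Y"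
    "\<forall>x\<in>X. \<forall>y\<in>Y. {x, y} \<in> edges G"
    by (elim exE conjE)
  have "complete_bipartite (induced_subgraph G (X \<union> Y))"
    by (rule complete_bipartite_induced_if_triangle_free[OF G(1,3) XY(1,2)]) (use XY(5) in blast)
  moreover have "X \<union> Y \<subseteq> verts G"
  proof -
    have "{x, y} \<subseteq> verts G" if "x \<in> X" "y \<in> Y" for x y
      using XY(5) that G(1) by (auto simp: simple_graph_def nsets_def)
    then show ?thesis
      using XY(1,2) by blast
  qed
  ultimately obtain B where "X \<union> Y \<subseteq> B" "biclique G B"
    using biclique_extension[OF G(2)] by blast
  then show ?L
    using R XY(3,4) by (intro exI[of _ B]) (auto simp: induced_subgraph_def)
qed

section \<open>Adjacency in the line graph and in the biclique line graph\<close>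

lemma opposite_in_four_cycle_sym:
  "opposite_in_four_cycle G e f \<Longrightarrow> opposite_in_four_cycle G f e"
proof -
  assume "opposite_in_four_cycle G e f"
  then obtain p q r s where
    "distinct [p, q, r, s]" "e = {p, q}" "f = {r, s}" "{p, q} \<in> edges G" "{q, r} \<in> edges G"
    "{r, s} \<in> edges G" "{p, s} \<in> edges G"
    unfolding opposite_in_four_cycle_def by blast
  then show ?thesis
    unfolding opposite_in_four_cycle_def
    by - (rule exI[of _ r], rule exI[of _ s], rule exI[of _ p], rule exI[of _ q],
          auto simp: insert_commute)
qed

lemma opposite_in_four_cycle_disjoint:
  "opposite_in_four_cycle G e f \<Longrightarrow> e \<inter> f = {} \<and> e \<noteq> f \<and> e \<in> edges G \<and> f \<in> edges G"
  unfolding opposite_in_four_cycle_def by auto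

lemma line_graph_edge_iff:
  "{e, f} \<in> edges (line_graph G) \<longleftrightarrow> e \<in> edges G \<and> f \<in> edges G \<and> e \<noteq> f \<and> e \<inter> f \<noteq> {}"
  unfolding line_graph_def by (auto simp: doubleton_eq_iff)

lemma biclique_line_graph_edge_iff:
  assumes "simple_graph G" "finite (verts G)" "triangle_free G"
  shows "{e, f} \<in> edges (biclique_line_graph G) \<longleftrightarrow>
    {e, f} \<in> edges (line_graph G) \<or> opposite_in_four_cycle G e f"
proof -
  have "{e, f} \<in> edges (biclique_line_graph G) \<longleftrightarrow> e \<noteq> f \<and>
     (\<exists>B. biclique G B \<and> e \<in> edges (induced_subgraph G B) \<and> f \<in> edges (induced_subgraph G B))"
    unfolding biclique_line_graph_def by (auto simp: doubleton_eq_iff)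
  then show ?thesis
    unfolding common_biclique_iff[OF assms] line_graph_edge_iff
    using opposite_in_four_cycle_disjoint by blast
qed

section \<open>Induced four-cycles of the line graph\<close>

text \<open>In a simple graph every edge inside the four vertices is one of six pairs, so the
  induced subgraph is determined by the four sides and the two diagonals.\<close>

lemma induced_four_cycle_iff:
  assumes "simple_graph H"
  shows "induced_four_cycle H a b c d \<longleftrightarrow> distinct [a, b, c, d] \<and> {a, b, c, d} \<subseteq> verts H \<and>
    {a, b} \<in> edges H \<and> {b, c} \<in> edges H \<and> {c, d} \<in> edges H \<and> {a, d} \<in> edges H \<and>
    {a, c} \<notin> edges H \<and> {b, d} \<notin> edges H" (is "?L \<longleftrightarrow> ?R")
proof
  assume L: ?L
  then have dist: "distinct [a, b, c, d]"
    and V: "verts H \<inter> {a, b, c, d} = {a, b, c, d}"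
    and E: "{e \<in> edges H. e \<subseteq> {a, b, c, d}} = {{a, b}, {b, c}, {c, d}, {a, d}}"
    unfolding induced_four_cycle_def induced_subgraph_def by auto
  have *: "e \<in> edges H \<longleftrightarrow> e \<in> {{a, b}, {b, c}, {c, d}, {a, d}}" if "e \<subseteq> {a, b, c, d}" for e
    using E that by blast
  show ?R
    using dist V *[of "{a, c}"] *[of "{b, d}"] *[of "{a, b}"] *[of "{b, c}"] *[of "{c, d}"]
      *[of "{a, d}"]
    by (simp add: doubleton_eq_iff) blast
next
  assume R: ?R
  have "e \<in> {{a, b}, {b, c}, {c, d}, {a, d}}" if "e \<in> edges H" "e \<subseteq> {a, b, c, d}" for e
  proof -
    obtain x y where xy: "x \<noteq> y" "e = {x, y}"
      using assms \<open>e \<in> edges H\<close> by (blast elim: simple_graph_edgeE)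
    then have "x \<in> {a, b, c, d}" "y \<in> {a, b, c, d}" "{x, y} \<in> edges H"
      using that by auto
    \<comment> \<open>The case split runs over ordered pairs \<open>(x, y)\<close>, so the missing
      diagonals are needed in both orientations.\<close>
    moreover have "{c, a} \<notin> edges H" "{d, b} \<notin> edges H"
      using R by (simp_all add: insert_commute)
    ultimately have "(x, y) \<in> {(a, b), (b, a), (b, c), (c, b), (c, d), (d, c), (a, d), (d, a)}"
      using R xy(1) by (elim insertE emptyE) simp_all
    then show ?thesis
      unfolding xy(2) by (elim insertE emptyE) (simp_all add: doubleton_eq_iff)
  qed
  moreover have "{{a, b}, {b, c}, {c, d}, {a, d}} \<subseteq> {e \<in> edges H. e \<subseteq> {a, b, c, d}}"
    using R by simp
  ultimately have "{e \<in> edges H. e \<subseteq> {a, b, c, d}} = {{a, b}, {b, c}, {c, d}, {a, d}}"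
    by blast
  then show ?L
    using R unfolding induced_four_cycle_def induced_subgraph_def by auto
qed

lemma simple_line_graph: "simple_graph (line_graph G)"
  unfolding simple_graph_def line_graph_def by (auto simp: nsets_def card_2_iff)

text \<open>Consecutive edges of the cycle meet and opposite ones are disjoint. Choosing one meeting
  point for each consecutive pair gives four vertices, and two of them coinciding would make
  opposite edges meet. Each edge contains two of these points and so equals that pair.\<close>

lemma induced_four_cycle_line_graph_opposite:
  assumes G: "simple_graph G" and C: "induced_four_cycle (line_graph G) a b c d"
  shows "opposite_in_four_cycle G a c"
proof -
  note C' = C[unfolded induced_four_cycle_iff[OF simple_line_graph] line_graph_edge_iff]
  have E: "a \<in> edges G" "b \<in> edges G" "c \<in> edges G" "d \<in> edges G"
    using C' by blast+
  have meet: "a \<inter> b \<noteq> {}" "b \<inter> c \<noteq> {}" "c \<inter> d \<noteq> {}" "a \<inter> d \<noteq> {}"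
    using C' by argo+
  have "a \<noteq> c" "b \<noteq> d"
    using C' by simp_all
  then have disj: "a \<inter> c = {}" "b \<inter> d = {}"
    using C' E by argo+
  obtain q r where qr: "q \<in> a" "q \<in> b" "r \<in> b" "r \<in> c"
    using meet by blast
  obtain p s where ps: "p \<in> a" "p \<in> d" "s \<in> d" "s \<in> c"
    using meet by blast
  have dist': "distinct [p, q, r, s]"
    using qr ps disj by auto
  then have "a = {p, q}" "b = {q, r}" "c = {r, s}" "d = {p, s}"
    using simple_graph_edge_eq[OF G] qr ps E by simp_all
  then show ?thesis
    unfolding opposite_in_four_cycle_def using dist' E by blast
qed

text \<open>The four edges of the cycle in \<open>G\<close>, taken in order, form the cycle in the
  line graph; the witnesses \<open>b\<close> and \<open>d\<close> are the two connecting
  edges.\<close>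

lemma opposite_imp_induced_four_cycle_line_graph:
  assumes "opposite_in_four_cycle G a c"
  obtains b d where "induced_four_cycle (line_graph G) a b c d"
proof -
  obtain p q r s where *: "distinct [p, q, r, s]" "a = {p, q}" "c = {r, s}"
    "{p, q} \<in> edges G" "{q, r} \<in> edges G" "{r, s} \<in> edges G" "{p, s} \<in> edges G"
    using assms unfolding opposite_in_four_cycle_def by blast
  have "induced_four_cycle (line_graph G) {p, q} {q, r} {r, s} {p, s}"
    unfolding induced_four_cycle_iff[OF simple_line_graph] line_graph_edge_iff
    using * by (auto simp: line_graph_def doubleton_eq_iff)
  then show thesis
    using that * by blast
qed

text \<open>Transfers facts about the diagonal \<open>{a, c}\<close> to the diagonal
  \<open>{b, d}\<close>.\<close>

lemma induced_four_cycle_rotate: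
  assumes "simple_graph H" and "induced_four_cycle H a b c d"
  shows "induced_four_cycle H b c d a"
  using assms(2) unfolding induced_four_cycle_iff[OF assms(1)] by (auto simp: insert_commute)

text \<open>Condition (ii) fixes the vertices of the four-cycle but not their cyclic order.
  Non-adjacency of \<open>a\<close> and \<open>c\<close> forces them to be opposite in whichever
  order occurs.\<close>

lemma opposite_if_induces_four_cycle_line_graph:
  assumes G: "simple_graph G" and S: "induces_four_cycle (line_graph G) S"
    and ac: "a \<in> S" "c \<in> S" "a \<noteq> c" "{a, c} \<notin> edges (line_graph G)"
  shows "opposite_in_four_cycle G a c"
proof -
  let ?E = "edges (line_graph G)"
  obtain x y z w where S_eq: "S = {x, y, z, w}" and C: "induced_four_cycle (line_graph G) x y z w"
    using S unfolding induces_four_cycle_def by blast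
  have "opposite_in_four_cycle G x z" "opposite_in_four_cycle G y w"
    using induced_four_cycle_line_graph_opposite[OF G] C
      induced_four_cycle_rotate[OF simple_line_graph C] by blast+
  \<comment> \<open>The four sides are edges of the line graph, which leaves only the two
    diagonals.\<close>
  moreover have "{a, c} = {x, z} \<or> {a, c} = {y, w}"
  proof -
    have "{x, y} \<in> ?E" "{y, z} \<in> ?E" "{z, w} \<in> ?E" "{x, w} \<in> ?E"
      using C unfolding induced_four_cycle_iff[OF simple_line_graph] by blast+
    then have "{a, c} \<notin> {{x, y}, {y, z}, {z, w}, {x, w}}"
      using ac(4) by auto
    then show ?thesis
      using ac(1-3) unfolding S_eq by (elim insertE emptyE) (simp_all add: doubleton_eq_iff)
  qed
  ultimately show ?thesis
    using opposite_in_four_cycle_sym by (metis doubleton_eq_iff)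
qed

theorem theorem15:
  fixes G :: "'a ugraph" and H :: "'a set ugraph"
  assumes "simple_graph G" and "finite (verts G)" and "triangle_free G"
    and "simple_graph H" and "verts H = edges G"
  shows "H = biclique_line_graph G \<longleftrightarrow>
    (\<exists>F \<subseteq> edges H.
       delete_edges H F = line_graph G \<and>
       (\<forall>a b c d. induced_four_cycle (delete_edges H F) a b c d \<longrightarrow> {a, c} \<in> F \<and> {b, d} \<in> F) \<and>
       (\<forall>a c. {a, c} \<in> F \<longrightarrow>
          (\<exists>b d. {b, d} \<in> F \<and> induces_four_cycle (delete_edges H F) {a, b, c, d})))"
    (is "_ \<longleftrightarrow> (\<exists>F \<subseteq> edges H. ?P F)")
proof
  note edge_iff = biclique_line_graph_edge_iff[OF assms(1-3)]
  assume H: "H = biclique_line_graph G"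
  \<comment> \<open>The choice is forced by \<open>F \<subseteq> edges H\<close> and
    \<open>H - F = L(G)\<close>.\<close>
  define F where "F = edges H - edges (line_graph G)"
  \<comment> \<open>Opposite edges are disjoint, hence never adjacent in the line graph, so removing
    its edges keeps exactly the opposite pairs.\<close>
  have F_iff: "{e, f} \<in> F \<longleftrightarrow> opposite_in_four_cycle G e f" for e f
    unfolding F_def H Diff_iff edge_iff
    using line_graph_edge_iff[of e f G] opposite_in_four_cycle_disjoint[of G e f] by blast
  have "edges (line_graph G) \<subseteq> edges H"
  proof
    fix x assume x: "x \<in> edges (line_graph G)"
    then obtain e f where "x = {e, f}"
      by (rule simple_graph_edgeE[OF simple_line_graph])
    then show "x \<in> edges H"
      using x edge_iff[of e f] unfolding H by simp
  qed
  moreover have "verts (line_graph G) = verts H"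
    using assms(5) by (simp add: line_graph_def)
  ultimately have del: "delete_edges H F = line_graph G"
    by (cases "line_graph G") (auto simp: delete_edges_def F_def)
  have "?P F"
    unfolding del
  proof (intro conjI allI impI)
    show "line_graph G = line_graph G" ..
  next
    fix a b c d assume "induced_four_cycle (line_graph G) a b c d"
    then show "{a, c} \<in> F" "{b, d} \<in> F"
      using induced_four_cycle_line_graph_opposite[OF assms(1)]
        induced_four_cycle_rotate[OF simple_line_graph] F_iff by blast+
  next
    fix a c assume "{a, c} \<in> F"
    then obtain b d where C: "induced_four_cycle (line_graph G) a b c d"
      using F_iff opposite_imp_induced_four_cycle_line_graph by blast
    then have "{b, d} \<in> F"
      using induced_four_cycle_line_graph_opposite[OF assms(1)]
        induced_four_cycle_rotate[OF simple_line_graph] F_iff by blast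
    then show "\<exists>b d. {b, d} \<in> F \<and> induces_four_cycle (line_graph G) {a, b, c, d}"
      using C unfolding induces_four_cycle_def by blast
  qed
  then show "\<exists>F \<subseteq> edges H. ?P F"
    unfolding F_def by blast
next
  note edge_iff = biclique_line_graph_edge_iff[OF assms(1-3)]
  assume "\<exists>F \<subseteq> edges H. ?P F"
  then obtain F where F: "F \<subseteq> edges H" and "?P F"
    by blast
  then have del: "delete_edges H F = line_graph G"
    and i: "\<And>a b c d. induced_four_cycle (line_graph G) a b c d \<Longrightarrow> {a, c} \<in> F"
    and ii: "\<And>a c. {a, c} \<in> F \<Longrightarrow> \<exists>b d. induces_four_cycle (line_graph G) {a, b, c, d}"
    by (simp, metis, metis)
  have L: "edges (line_graph G) = edges H - F"
    unfolding del[symmetric] by (simp add: delete_edges_def)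
  \<comment> \<open>Condition (i) puts every opposite pair into \<open>F\<close>. Conversely, a pair
    in \<open>F\<close> is not an edge of the line graph, so it is a diagonal of the four-cycle
    given by (ii).\<close>
  have "opposite_in_four_cycle G a c \<longleftrightarrow> {a, c} \<in> F" for a c
  proof
    assume "opposite_in_four_cycle G a c"
    then obtain b d where "induced_four_cycle (line_graph G) a b c d"
      by (rule opposite_imp_induced_four_cycle_line_graph)
    then show "{a, c} \<in> F"
      by (rule i)
  next
    assume ac: "{a, c} \<in> F"
    \<comment> \<open>If \<open>a = c\<close>, the set \<open>{a, c}\<close> would be a singleton
      and hence a loop of \<open>H\<close>.\<close>
    then have "a \<noteq> c"
      using F simple_graph_no_loop[OF assms(4)] by fastforce
    moreover obtain b d where "induces_four_cycle (line_graph G) {a, b, c, d}"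
      using ii[OF ac] by blast
    ultimately show "opposite_in_four_cycle G a c"
      using opposite_if_induces_four_cycle_line_graph[OF assms(1)] ac L by simp
  qed
  then have iff: "{e, f} \<in> edges (biclique_line_graph G) \<longleftrightarrow> {e, f} \<in> edges H" for e f
    using edge_iff[of e f] L F by auto
  \<comment> \<open>The equivalence \<open>iff\<close> concerns sets of the form
    \<open>{e, f}\<close>; every edge has this form, in \<open>H\<close> by simplicity and in the
    biclique line graph by construction.\<close>
  have "edges H = edges (biclique_line_graph G)"
  proof
    show "edges H \<subseteq> edges (biclique_line_graph G)"
    proof
      fix x assume x: "x \<in> edges H"
      then obtain e f where "x = {e, f}"
        by (rule simple_graph_edgeE[OF assms(4)])
      then show "x \<in> edges (biclique_line_graph G)"
        using x iff[of e f] by simp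
    qed
    show "edges (biclique_line_graph G) \<subseteq> edges H"
    proof
      fix x assume x: "x \<in> edges (biclique_line_graph G)"
      then obtain e f where "x = {e, f}"
        unfolding biclique_line_graph_def by auto
      then show "x \<in> edges H"
        using x iff[of e f] by simp
    qed
  qed
  moreover have "verts H = verts (biclique_line_graph G)"
    using assms(5) by (simp add: biclique_line_graph_def)
  ultimately show "H = biclique_line_graph G"
    by (simp add: ugraph.expand)
qed

end
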